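(* Let $K$ be an arbitrary unital associative commutative ring and $K\langle Y\rangle$ the free associative unital $K$-algebra on a non-empty set $Y$. Let $T^{(4)}$ be the two-sided ideal of $K\langle Y\rangle$ generated by all $[a_1,a_2,a_3,a_4]$ ($a_i\in K\langle Y\rangle$). Then $T^{(4)}$ is generated as a two-sided ideal by the polynomials (with all $y_i\in Y$) \begin{gather*} [y_1,y_2,y_3,y_4],\qquad [y_1,y_2,y_3][y_4,y_5,y_6],\\ [y_1,y_2][y_3,y_4,y_5]+[y_1,y_5][y_3,y_4,y_2],\qquad [y_1,y_2][y_3,y_4,y_5]+[y_1,y_4][y_3,y_2,y_5],\\ ([y_1,y_2][y_3,y_4]+[y_1,y_3][y_2,y_4])[y_5,y_6]. \end{gather*}
   Context: Commutators are left-normed: $[a,b]=ab-ba$, $[a_1,\dots,a_n]=[[a_1,\dots,a_{n-1}],a_n]$. *)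

theory Defs
  imports "HOL-Library.Poly_Mapping"
begin

datatype 'y fword = FWord "'y list"

instantiation fword :: (type) monoid_add
begin
definition zero_fword :: "'y fword" where "zero_fword = FWord []"
fun plus_fword :: "'y fword \<Rightarrow> 'y fword \<Rightarrow> 'y fword" where
  "plus_fword (FWord u) (FWord v) = FWord (u @ v)"
instance
proof
  fix a b c :: "'y fword"
  show "a + b + c = a + (b + c)" by (cases a; cases b; cases c) simp
  show "0 + a = a" by (cases a) (simp add: zero_fword_def)
  show "a + 0 = a" by (cases a) (simp add: zero_fword_def)
qed
end

text \<open>The free associative unital K-algebra K<Y> = monoid algebra of the free monoid on Y.
  It is a ring_1 via the Poly_Mapping convolution product.\<close>
type_synonym ('k, 'y) free_alg = "'y fword \<Rightarrow>\<^sub>0 'k"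

definition fvar :: "'y \<Rightarrow> ('k::comm_ring_1, 'y) free_alg" where
  "fvar y = Poly_Mapping.single (FWord [y]) 1"

definition comm :: "'a::ring \<Rightarrow> 'a \<Rightarrow> 'a" where
  "comm a b = a * b - b * a"

inductive_set ideal_gen :: "'a::ring_1 set \<Rightarrow> 'a set" for S where
  gen: "s \<in> S \<Longrightarrow> s \<in> ideal_gen S"
| zero: "0 \<in> ideal_gen S"
| add: "a \<in> ideal_gen S \<Longrightarrow> b \<in> ideal_gen S \<Longrightarrow> a + b \<in> ideal_gen S"
| lmult: "a \<in> ideal_gen S \<Longrightarrow> c * a \<in> ideal_gen S"
| rmult: "a \<in> ideal_gen S \<Longrightarrow> a * c \<in> ideal_gen S"

end

theory Submission
  imports Defs
begin

text \<open>
  Expanding one of the five polynomials at a product \<open>x * x'\<close> in one argument gives multiples of the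
  same polynomial at \<open>x\<close> and at \<open>x'\<close>, plus a remainder built from the other families. Read one way,
  with every fourfold commutator in the ideal, these expansions produce the remaining families: the
  fourfold commutator gives \<open>skew25\<close>, then \<open>skew24\<close>; \<open>skew25\<close> gives \<open>comm33\<close>; \<open>skew24\<close> gives
  \<open>skew23\<close>. Read the other way, they prove by induction on the total length that all five families
  vanish on words modulo the ideal generated by their values on variables. At length \<open>n\<close> the
  remainders for \<open>skew23\<close> and \<open>comm33\<close> reduce to identities of length below \<open>n\<close>, because in a product
  of a triple commutator with pairs the relations of length below \<open>n\<close> already allow any two arguments
  to be exchanged up to sign; \<open>skew25\<close> and \<open>skew24\<close> then need \<open>skew23\<close> and \<open>comm33\<close> at length \<open>n\<close>,
  and the fourfold commutator needs \<open>skew25\<close> and \<open>skew24\<close> at length \<open>n\<close>.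
\<close>

section \<open>The five families of polynomials and their symmetries\<close>

abbreviation (input) comm3 :: "'a::ring \<Rightarrow> 'a \<Rightarrow> 'a \<Rightarrow> 'a" where
  "comm3 a b c \<equiv> comm (comm a b) c"

definition comm4 :: "'a::ring \<Rightarrow> 'a \<Rightarrow> 'a \<Rightarrow> 'a \<Rightarrow> 'a" where
  "comm4 a b c d = comm (comm3 a b c) d"

definition comm33 :: "'a::ring \<Rightarrow> 'a \<Rightarrow> 'a \<Rightarrow> 'a \<Rightarrow> 'a \<Rightarrow> 'a \<Rightarrow> 'a" where
  "comm33 a b c d e f = comm3 a b c * comm3 d e f"

text \<open>The digits name the two argument positions that are symmetrized:
  \<open>skew25 a b c d e\<close> is zero modulo an ideal exactly when
  \<open>comm a b * comm3 c d e\<close> changes sign there under exchange of its second and fifth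
  arguments. The names \<open>skew24\<close> and \<open>skew23\<close> are read the same
  way.\<close>

definition skew25 :: "'a::ring \<Rightarrow> 'a \<Rightarrow> 'a \<Rightarrow> 'a \<Rightarrow> 'a \<Rightarrow> 'a" where
  "skew25 a b c d e = comm a b * comm3 c d e + comm a e * comm3 c d b"

definition skew24 :: "'a::ring \<Rightarrow> 'a \<Rightarrow> 'a \<Rightarrow> 'a \<Rightarrow> 'a \<Rightarrow> 'a" where
  "skew24 a b c d e = comm a b * comm3 c d e + comm a d * comm3 c b e"

definition skew23 :: "'a::ring \<Rightarrow> 'a \<Rightarrow> 'a \<Rightarrow> 'a \<Rightarrow> 'a \<Rightarrow> 'a \<Rightarrow> 'a" where
  "skew23 a b c d e f = (comm a b * comm c d + comm a c * comm b d) * comm e f"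

lemmas poly_defs = comm4_def comm33_def skew25_def skew24_def skew23_def

text \<open>This and the next symmetries spare an expansion: of two arguments that are exchanged up
  to sign, only one has to be expanded along a product.\<close>

lemma comm4_swap: "comm4 b a c d = - comm4 a b c d"
  by (simp add: poly_defs comm_def algebra_simps)

lemma comm33_swap:
  "comm33 b a c d e f = - comm33 a b c d e f"
  by (simp add: poly_defs comm_def algebra_simps)

lemma skew25_swap:
  "skew25 a e c d b = skew25 a b c d e" "skew25 a b d c e = - skew25 a b c d e"
  by (simp_all add: poly_defs comm_def algebra_simps)

lemma skew24_swap: "skew24 a d c b e = skew24 a b c d e"
  by (simp add: poly_defs)

lemma skew23_swap:
  "skew23 a c b d e f = skew23 a b c d e f" "skew23 a b c d f e = - skew23 a b c d e f"
  by (simp_all add: poly_defs comm_def algebra_simps)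

subsection \<open>Expansion along a product\<close>

text \<open>Commutation with a fixed element is a derivation, so the Leibniz rule gives two
  multiples and six cross terms, in which \<open>b\<close>, \<open>c\<close>, \<open>d\<close> are
  distributed over \<open>a\<close> and \<open>a'\<close>. The cross terms pair up into two
  \<open>skew25\<close> and one \<open>skew24\<close> once three triple commutators are moved past a
  pair.\<close>

lemma comm4_mult1:
  "comm4 (a * a') b c d = a * comm4 a' b c d + comm4 a b c d * a'
    + skew25 a c a' b d + skew25 a' d a b c + skew24 b a c a' d
    + comm (comm3 a c d) (comm a' b) + comm (comm3 a b c) (comm a' d)
    + comm (comm3 a b d) (comm a' c)"
  by (simp add: poly_defs comm_def algebra_simps)

lemma comm4_mult3:
  "comm4 a b (c * c') d = c * comm4 a b c' d + comm4 a b c d * c'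
    - skew25 d c a b c' + comm (comm3 a b c) (comm c' d)"
  by (simp add: poly_defs comm_def algebra_simps)

lemma comm4_mult4: "comm4 a b c (d * d') = d * comm4 a b c d' + comm4 a b c d * d'"
  by (simp add: poly_defs comm_def algebra_simps)

lemma skew25_mult1:
  "skew25 (a * a') b c d e = a * skew25 a' b c d e + skew25 a b c d e * a'
    - comm a b * comm4 c d e a' - comm a e * comm4 c d b a'"
  by (simp add: poly_defs comm_def algebra_simps)

text \<open>The \<open>comm33\<close> term is the cost of moving \<open>b\<close> to the left past
  \<open>comm a e\<close>.\<close>

lemma skew25_mult2:
  "skew25 a (b * b') c d e = b * skew25 a b' c d e + skew25 a b c d e * b'
    - comm a b * comm4 c d e b' + comm33 a e b c d b'"
  by (simp add: poly_defs comm_def algebra_simps)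

lemma skew25_mult3:
  "skew25 a b (c * c') d e = c * skew25 a b c' d e + skew25 a b c d e * c'
    + comm33 a b c c' d e + comm33 a e c c' d b
    - skew23 a b e c c' d - skew23 a b e c' c d
    + comm a b * comm (comm c d) (comm c' e) + comm a e * comm (comm c d) (comm c' b)"
  by (simp add: poly_defs comm_def algebra_simps)

lemma skew24_mult1:
  "skew24 (a * a') b c d e = a * skew24 a' b c d e + skew24 a b c d e * a'
    - comm a b * comm4 c d e a' - comm a d * comm4 c b e a'"
  by (simp add: poly_defs comm_def algebra_simps)

lemma skew24_mult3:
  "skew24 a b (c * c') d e = c * skew24 a b c' d e + skew24 a b c d e * c'
    + comm33 a b c c' d e + comm33 a d c c' b e
    - skew23 a b d c' c e - skew23 a b d c c' e
    + comm a b * comm (comm c e) (comm c' d) + comm a d * comm (comm c e) (comm c' b)"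
  by (simp add: poly_defs comm_def algebra_simps)

text \<open>The cross terms of \<open>comm3 c (d * d') e\<close> are
  \<open>comm c d * comm d' e\<close> and \<open>comm d e * comm c d'\<close>. Moving
  \<open>comm a b\<close> behind them produces one \<open>skew23\<close>, at the cost of commutators
  of pairs.\<close>

lemma skew24_mult4:
  "skew24 a b c (d * d') e = d * skew24 a b c d' e + skew24 a b c d e * d'
    + comm33 a b d c d' e - comm a d * comm4 c b e d' + skew23 c d d' e a b
    + comm (comm a b) (comm c d) * comm d' e + comm c d * comm (comm a b) (comm d' e)
    + comm (comm a b) (comm c d') * comm d e + comm c d' * comm (comm a b) (comm d e)
    + comm a b * comm (comm d e) (comm c d')"
  by (simp add: poly_defs comm_def algebra_simps)

lemma skew24_mult5:
  "skew24 a b c d (e * e') = e * skew24 a b c d e' + skew24 a b c d e * e'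
    + comm33 a b e c d e' + comm33 a d e c b e'"
  by (simp add: poly_defs comm_def algebra_simps)

text \<open>The last summand collects the cross terms. It belongs to none of the five families and
  has the shape of \<open>pair_pair_triple_eq\<close>.\<close>

lemma comm33_mult1:
  "comm33 (a * a') b c d e f = a * comm33 a' b c d e f + comm33 a b c d e f * a'
    - comm3 a b c * comm4 d e f a'
    + (comm a c * comm a' b + comm a b * comm a' c) * comm3 d e f"
  by (simp add: poly_defs comm_def algebra_simps)

lemma comm33_mult3:
  "comm33 a b (c * c') d e f = c * comm33 a b c' d e f + comm33 a b c d e f * c'
    - comm3 a b c * comm4 d e f c'"
  by (simp add: poly_defs comm_def algebra_simps)

lemma skew23_mult1:
  "skew23 (a * a') b c d e f = a * skew23 a' b c d e f + a' * skew23 a b c d e f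
    + (comm3 a b a' * comm c d + comm3 a c a' * comm b d) * comm e f"
  by (simp add: poly_defs comm_def algebra_simps)

text \<open>Moving \<open>b\<close> to the left and \<open>b'\<close> to the right past pairs leaves
  triple commutators. Writing \<open>comm d c\<close> and \<open>comm d b\<close> absorbs a sign, so
  that the term with \<open>comm3 e f b'\<close> has the shape of
  \<open>pair_pair_triple_eq\<close>.\<close>

lemma skew23_mult2:
  "skew23 a (b * b') c d e f = b * skew23 a b' c d e f + skew23 a b c d e f * b'
    + (comm a b * comm d c + comm a c * comm d b) * comm3 e f b'
    + (comm3 a c b * comm b' d - comm a b * comm3 c d b') * comm e f"
  by (simp add: poly_defs comm_def algebra_simps)

lemma skew23_mult4:
  "skew23 a b c (d * d') e f = d * skew23 a b c d' e f + skew23 a b c d e f * d'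
    + (comm a b * comm d c + comm a c * comm d b) * comm3 e f d'
    + (comm3 a b d * comm c d' + comm3 a c d * comm b d') * comm e f"
  by (simp add: poly_defs comm_def algebra_simps)

lemma skew23_mult5:
  "skew23 a b c d (e * e') f = e * skew23 a b c d e' f + skew23 a b c d e f * e'
    + (comm3 a b e * comm c d + comm3 a c e * comm b d
       + (comm a b * comm3 c d e + comm a c * comm3 b d e)) * comm e' f"
  by (simp add: poly_defs comm_def algebra_simps)

subsection \<open>Further relations modulo the five families\<close>

text \<open>The exchange of \<open>q\<close> and \<open>s\<close> is made of three exchanges with
  the last slot of the triple commutator, each an instance of \<open>skew25\<close> and each
  changing the sign. Between them the two pairs are commuted so that the required one stands next to
  the triple.\<close>

lemma pair_pair_triple_eq:
  "(comm p q * comm r s + comm p s * comm r q) * comm3 d e f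
    = comm p s * skew25 r q d e f - comm (comm p s) (comm r f) * comm3 d e q
      - comm r f * skew25 p s d e q - comm (comm p q) (comm r f) * comm3 d e s
      + comm p q * skew25 r f d e s"
  \<comment> \<open>Only commutators of two pairs are unfolded; the pairs themselves stay
    atomic.\<close>
  by (simp add: skew25_def comm_def[of "comm _ _" "comm _ _"] algebra_simps)

lemma triple_pair_skew_eq:
  "comm3 a b x * comm c d + comm3 a c x * comm b d
    = comm (comm3 a b x) (comm c d) + comm (comm3 a c x) (comm b d) - skew24 d c a b x"
  by (simp add: poly_defs comm_def algebra_simps)

text \<open>With the pair moved to the front, three exchanges lead from one product to the other:
  \<open>b'\<close> with \<open>b\<close>, then \<open>d\<close> with \<open>c\<close>, then
  \<open>c\<close> with \<open>a\<close>.\<close>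

lemma triple_pair_shift_eq:
  "comm3 a c b * comm b' d - comm a b * comm3 c d b'
    = comm (comm3 a c b) (comm b' d) - skew25 d b' a c b - skew24 b d a c b' - skew24 b c d a b'"
  by (simp add: poly_defs comm_def algebra_simps)

lemma pair_triple_skew_eq:
  "comm a b * comm3 c d e + comm a c * comm3 b d e = - skew24 a b d c e"
  by (simp add: poly_defs comm_def algebra_simps)

section \<open>Commutators modulo a two-sided ideal\<close>

locale two_sided_ideal =
  fixes I :: "'a::ring_1 set"
  assumes zero_mem: "0 \<in> I"
    and add_mem: "x \<in> I \<Longrightarrow> y \<in> I \<Longrightarrow> x + y \<in> I"
    and lmult_mem: "x \<in> I \<Longrightarrow> c * x \<in> I"
    and rmult_mem: "x \<in> I \<Longrightarrow> x * c \<in> I"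
begin

lemma uminus_mem: "x \<in> I \<Longrightarrow> - x \<in> I"
  using lmult_mem[of x "- 1"] by simp

lemma diff_mem: "x \<in> I \<Longrightarrow> y \<in> I \<Longrightarrow> x - y \<in> I"
  using add_mem[of x "- y"] uminus_mem by simp

lemmas mem_intros = add_mem diff_mem uminus_mem lmult_mem rmult_mem

text \<open>Since \<open>comm v\<close> is a derivation, the elements commuting with
  \<open>v\<close> modulo \<open>I\<close> are closed under products and differences.\<close>

lemma comm_comm_mem:
  assumes "comm v x \<in> I" "comm v y \<in> I"
  shows "comm v (comm x y) \<in> I"
proof -
  have "comm v (comm x y) = comm v x * y + x * comm v y - comm v y * x - y * comm v x"
    by (simp add: comm_def algebra_simps)
  with assms show ?thesis by (simp add: mem_intros)
qed

text \<open>This is the Jacobi identity.\<close>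

lemma comm_pairs_mem:
  assumes "comm4 a b c d \<in> I" "comm4 a b d c \<in> I"
  shows "comm (comm a b) (comm c d) \<in> I"
proof -
  have "comm (comm a b) (comm c d) = comm4 a b c d - comm4 a b d c"
    by (simp add: comm4_def comm_def algebra_simps)
  with assms show ?thesis by (simp add: diff_mem)
qed

end

lemma ideal_gen_two_sided: "two_sided_ideal (ideal_gen S)"
  by unfold_locales (auto intro: ideal_gen.intros)

lemma ideal_gen_subset:
  assumes "\<And>s. s \<in> S \<Longrightarrow> s \<in> ideal_gen S'"
  shows "ideal_gen S \<subseteq> ideal_gen S'"
proof
  fix x assume "x \<in> ideal_gen S"
  then show "x \<in> ideal_gen S'"
    by induction (auto intro: assms ideal_gen.intros)
qed

subsection \<open>The five families lie in the ideal of all fourfold commutators\<close>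

locale comm4_ideal = two_sided_ideal I for I :: "'a::ring_1 set" +
  assumes c4: "comm4 a b c d \<in> I"
begin

lemma c3_pair: "comm (comm3 a b c) (comm d e) \<in> I"
  using c4 by (intro comm_comm_mem) (simp_all add: comm4_def)

lemma pairs: "comm (comm a b) (comm c d) \<in> I"
  by (intro comm_pairs_mem c4)

lemma s25: "skew25 a b c d e \<in> I"
proof -
  have "skew25 a b c d e = b * comm4 c d e a + comm4 c d b a * e
      + comm (comm3 c d b) (comm e a) - comm4 c d (b * e) a"
    by (simp add: comm4_mult3)
  then show ?thesis by (simp add: mem_intros c4 c3_pair)
qed

text \<open>In \<open>comm4_mult1\<close> at the product \<open>b * d\<close>, every term other than
  this one is already known to lie in \<open>I\<close>.\<close>

lemma s24: "skew24 a b c d e \<in> I"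
proof -
  have "skew24 a b c d e = comm4 (b * d) a c e - b * comm4 d a c e - comm4 b a c e * d
      - skew25 b c d a e - skew25 d e b a c - comm (comm3 b c e) (comm d a)
      - comm (comm3 b a c) (comm d e) - comm (comm3 b a e) (comm d c)"
    by (simp add: comm4_mult1)
  then show ?thesis by (simp add: mem_intros c4 c3_pair s25)
qed

lemma c33: "comm33 a b c d e f \<in> I"
proof -
  have "comm33 a b c d e f = skew25 a (c * f) d e b - c * skew25 a f d e b
      - skew25 a c d e b * f + comm a c * comm4 d e b f"
    by (simp add: skew25_mult2)
  then show ?thesis by (simp add: mem_intros c4 s25)
qed

lemma s23: "skew23 a b c d e f \<in> I"
proof -
  have "skew23 a b c d e f = skew24 e f a (b * c) d - b * skew24 e f a c d - skew24 e f a b d * c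
    - comm33 e f b a c d + comm e b * comm4 a f d c
    - comm (comm e f) (comm a b) * comm c d - comm a b * comm (comm e f) (comm c d)
    - comm (comm e f) (comm a c) * comm b d - comm a c * comm (comm e f) (comm b d)
    - comm e f * comm (comm b d) (comm a c)"
    by (simp add: skew24_mult4)
  then show ?thesis by (simp add: mem_intros c4 s24 c33 pairs)
qed

end

subsection \<open>Induction on the total degree\<close>

text \<open>The induction hypothesis, packaged so that the step can be spread over many lemmas. One
  bound \<open>n\<close> on the total length serves all five families at once. The assumptions
  \<open>gen_c4\<close> to \<open>gen_s23\<close> cover words that are single letters and cannot be
  split.\<close>

locale identities_below = two_sided_ideal I for I :: "'a::ring_1 set" +
  fixes m :: "'y list \<Rightarrow> 'a" and n :: nat
  assumes m_append: "m (u @ v) = m u * m v"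
    and m_Nil: "m [] = 1"
    and c4: "length a + length b + length c + length d < n
      \<Longrightarrow> comm4 (m a) (m b) (m c) (m d) \<in> I"
    and c33: "length a + length b + length c + length d + length e + length f < n
      \<Longrightarrow> comm33 (m a) (m b) (m c) (m d) (m e) (m f) \<in> I"
    and s25: "length a + length b + length c + length d + length e < n
      \<Longrightarrow> skew25 (m a) (m b) (m c) (m d) (m e) \<in> I"
    and s24: "length a + length b + length c + length d + length e < n
      \<Longrightarrow> skew24 (m a) (m b) (m c) (m d) (m e) \<in> I"
    and s23: "length a + length b + length c + length d + length e + length f < n
      \<Longrightarrow> skew23 (m a) (m b) (m c) (m d) (m e) (m f) \<in> I"
    and gen_c4: "comm4 (m [y1]) (m [y2]) (m [y3]) (m [y4]) \<in> I"
    and gen_c33: "comm33 (m [y1]) (m [y2]) (m [y3]) (m [y4]) (m [y5]) (m [y6]) \<in> I"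
    and gen_s25: "skew25 (m [y1]) (m [y2]) (m [y3]) (m [y4]) (m [y5]) \<in> I"
    and gen_s24: "skew24 (m [y1]) (m [y2]) (m [y3]) (m [y4]) (m [y5]) \<in> I"
    and gen_s23: "skew23 (m [y1]) (m [y2]) (m [y3]) (m [y4]) (m [y5]) (m [y6]) \<in> I"
begin

lemma c3_pair:
  assumes "length a + length b + length c + length d < n"
    "length a + length b + length c + length e < n"
  shows "comm (comm3 (m a) (m b) (m c)) (comm (m d) (m e)) \<in> I"
  using assms c4 by (intro comm_comm_mem) (simp_all add: comm4_def)

lemma pairs:
  assumes "length a + length b + length c + length d < n"
  shows "comm (comm (m a) (m b)) (comm (m c) (m d)) \<in> I"
  using assms by (intro comm_pairs_mem c4) simp_all

text \<open>Here the total length may equal \<open>n\<close>: each \<open>skew25\<close> and each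
  commutator of pairs in \<open>pair_pair_triple_eq\<close> omits at least two of the seven nonempty
  words, hence falls below \<open>n\<close>.\<close>

lemma pair_pair_triple:
  assumes "length p + length q + length r + length s + length d + length e + length f \<le> n"
    "p \<noteq> []" "q \<noteq> []" "r \<noteq> []" "s \<noteq> []" "d \<noteq> []" "e \<noteq> []" "f \<noteq> []"
  shows "(comm (m p) (m q) * comm (m r) (m s) + comm (m p) (m s) * comm (m r) (m q))
    * comm3 (m d) (m e) (m f) \<in> I"
proof -
  have "0 < length p" "0 < length q" "0 < length r" "0 < length s" "0 < length d" "0 < length e"
    "0 < length f"
    using assms by simp_all
  then show ?thesis
    unfolding pair_pair_triple_eq using assms(1)
    by (intro mem_intros lmult_mem[OF s25] rmult_mem[OF pairs]) linarith+
qed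

lemma triple_pair_skew:
  assumes "length a + length b + length x + length c + length d < n"
  shows "comm3 (m a) (m b) (m x) * comm (m c) (m d) + comm3 (m a) (m c) (m x) * comm (m b) (m d) \<in> I"
  unfolding triple_pair_skew_eq using assms by (intro add_mem diff_mem c3_pair s24) linarith+

lemma triple_pair_shift:
  assumes "length a + length b + length b' + length c + length d < n"
  shows "comm3 (m a) (m c) (m b) * comm (m b') (m d)
    - comm (m a) (m b) * comm3 (m c) (m d) (m b') \<in> I"
  unfolding triple_pair_shift_eq using assms by (intro add_mem diff_mem c3_pair s24 s25) linarith+

lemma pair_triple_skew:
  assumes "length a + length b + length c + length d + length e < n"
  shows "comm (m a) (m b) * comm3 (m c) (m d) (m e) + comm (m a) (m c) * comm3 (m b) (m d) (m e) \<in> I"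
  unfolding pair_triple_skew_eq using assms by (intro uminus_mem s24) linarith

lemma split_word:
  assumes "2 \<le> length w"
  obtains u v where "w = u @ v" "u \<noteq> []" "v \<noteq> []"
proof (cases w)
  case (Cons y v)
  then show ?thesis using that[of "[y]" v] assms by (cases "v = []") auto
qed (use assms in simp)

lemma comm_m_Nil: "comm (m []) x = 0" "comm x (m []) = 0" "comm 0 x = 0"
  by (simp_all add: m_Nil comm_def)


section \<open>Products of three pairs at length \<open>n\<close>\<close>

lemma s23_mult1:
  assumes "length u + length v + length b + length c + length d + length e + length f \<le> n"
    "0 < length u" "0 < length v" "0 < length e"
  shows "skew23 (m (u @ v)) (m b) (m c) (m d) (m e) (m f) \<in> I"
  unfolding m_append skew23_mult1 using assms
  by (intro add_mem lmult_mem[OF s23] rmult_mem[OF triple_pair_skew]) linarith+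

lemma s23_mult2:
  assumes "length a + length u + length v + length c + length d + length e + length f \<le> n"
    "a \<noteq> []" "u \<noteq> []" "v \<noteq> []" "c \<noteq> []" "d \<noteq> []" "e \<noteq> []" "f \<noteq> []"
  shows "skew23 (m a) (m (u @ v)) (m c) (m d) (m e) (m f) \<in> I"
proof -
  have "0 < length u" "0 < length v" "0 < length e" using assms by simp_all
  with assms show ?thesis
    unfolding m_append skew23_mult2
    by (intro add_mem lmult_mem[OF s23] rmult_mem[OF s23] rmult_mem[OF triple_pair_shift]
          pair_pair_triple) (assumption | linarith)+
qed

lemma s23_mult4:
  assumes "length a + length b + length c + length u + length v + length e + length f \<le> n"
    "a \<noteq> []" "u \<noteq> []" "v \<noteq> []" "b \<noteq> []" "c \<noteq> []" "e \<noteq> []" "f \<noteq> []"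
  shows "skew23 (m a) (m b) (m c) (m (u @ v)) (m e) (m f) \<in> I"
proof -
  have "0 < length u" "0 < length v" "0 < length e" using assms by simp_all
  with assms show ?thesis
    unfolding m_append skew23_mult4
    by (intro add_mem lmult_mem[OF s23] rmult_mem[OF s23] rmult_mem[OF triple_pair_skew]
          pair_pair_triple) (assumption | linarith)+
qed

lemma s23_mult5:
  assumes "length a + length b + length c + length d + length u + length v + length f \<le> n"
    "0 < length u" "0 < length v" "0 < length f"
  shows "skew23 (m a) (m b) (m c) (m d) (m (u @ v)) (m f) \<in> I"
  unfolding m_append skew23_mult5 using assms
  by (intro add_mem lmult_mem[OF s23] rmult_mem[OF s23]
      rmult_mem[OF add_mem[OF triple_pair_skew pair_triple_skew]]) linarith+

text \<open>An empty word stands for 1 and makes a commutator vanish. Otherwise some word splits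
  into two nonempty parts, and an expansion applies up to symmetry, or all words are letters. The
  other four families follow the same pattern.\<close>

lemma s23_le:
  assumes len: "length a + length b + length c + length d + length e + length f \<le> n"
  shows "skew23 (m a) (m b) (m c) (m d) (m e) (m f) \<in> I"
proof (cases "[] \<in> {a, b, c, d, e, f}")
  case True
  then show ?thesis by (auto simp: skew23_def comm_m_Nil zero_mem)
next
  case False
  then have ne: "a \<noteq> []" "b \<noteq> []" "c \<noteq> []" "d \<noteq> []" "e \<noteq> []" "f \<noteq> []" by auto
  consider "2 \<le> length a"
    | "2 \<le> length b" | "2 \<le> length c"
    | "2 \<le> length d" | "2 \<le> length e"
    | "2 \<le> length f"
    | "length a = 1" "length b = 1" "length c = 1" "length d = 1" "length e = 1" "length f = 1"
    using ne[folded length_greater_0_conv] by linarith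
  then show ?thesis
  proof cases
    case 1
    then obtain u v where "a = u @ v" "u \<noteq> []" "v \<noteq> []" by (rule split_word)
    with ne len show ?thesis by (simp add: s23_mult1)
  next
    case 2
    then obtain u v where "b = u @ v" "u \<noteq> []" "v \<noteq> []" by (rule split_word)
    with ne len show ?thesis by (simp add: s23_mult2)
  next
    case 3
    then obtain u v where "c = u @ v" "u \<noteq> []" "v \<noteq> []" by (rule split_word)
    with ne len s23_mult2[of a u v b d e f] show ?thesis by (simp add: skew23_swap(1))
  next
    case 4
    then obtain u v where "d = u @ v" "u \<noteq> []" "v \<noteq> []" by (rule split_word)
    with ne len show ?thesis by (simp add: s23_mult4)
  next
    case 5
    then obtain u v where "e = u @ v" "u \<noteq> []" "v \<noteq> []" by (rule split_word)
    with ne len show ?thesis by (simp add: s23_mult5)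
  next
    case 6
    then obtain u v where "f = u @ v" "u \<noteq> []" "v \<noteq> []" by (rule split_word)
    with ne len uminus_mem[OF s23_mult5[of a b c d u v e]] show ?thesis
      by (simp add: skew23_swap(2)[of _ _ _ _ "m e"])
  next
    case 7 then show ?thesis by (auto simp: length_Suc_conv gen_s23)
  qed
qed

section \<open>Products of two triple commutators at length \<open>n\<close>\<close>

lemma c33_mult1:
  assumes "length u + length v + length b + length c + length d + length e + length f \<le> n"
    "b \<noteq> []" "u \<noteq> []" "v \<noteq> []" "c \<noteq> []" "d \<noteq> []" "e \<noteq> []" "f \<noteq> []"
  shows "comm33 (m (u @ v)) (m b) (m c) (m d) (m e) (m f) \<in> I"
proof -
  have "0 < length u" "0 < length v" "0 < length b" using assms by simp_all
  with assms show ?thesis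
    unfolding m_append comm33_mult1
    by (intro add_mem diff_mem lmult_mem[OF c33] rmult_mem[OF c33] lmult_mem[OF c4]
          pair_pair_triple) (assumption | linarith)+
qed

lemma c33_mult3:
  assumes "length a + length b + length u + length v + length d + length e + length f \<le> n"
    "0 < length a" "0 < length u" "0 < length v"
  shows "comm33 (m a) (m b) (m (u @ v)) (m d) (m e) (m f) \<in> I"
  unfolding m_append comm33_mult3 using assms
  by (intro add_mem diff_mem lmult_mem[OF c33] rmult_mem[OF c33] lmult_mem[OF c4]) linarith+

text \<open>The left triple commutator commutes modulo \<open>I\<close> with each of
  \<open>m d\<close>, \<open>m e\<close>, \<open>m f\<close>, since these fourfold commutators have
  length below \<open>n\<close>; hence it commutes with the triple commutator built from
  them.\<close>

lemma c33_flip: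
  assumes "length a + length b + length c + length d + length e + length f \<le> n"
    "d \<noteq> []" "e \<noteq> []" "f \<noteq> []" "comm33 (m d) (m e) (m f) (m a) (m b) (m c) \<in> I"
  shows "comm33 (m a) (m b) (m c) (m d) (m e) (m f) \<in> I"
proof -
  have pos: "0 < length d" "0 < length e" "0 < length f" using assms by simp_all
  have "comm33 (m a) (m b) (m c) (m d) (m e) (m f) = comm33 (m d) (m e) (m f) (m a) (m b) (m c)
      + comm (comm3 (m a) (m b) (m c)) (comm3 (m d) (m e) (m f))"
    by (simp add: comm33_def comm_def[of "comm3 _ _ _" "comm3 _ _ _"])
  moreover have "comm (comm3 (m a) (m b) (m c)) (comm3 (m d) (m e) (m f)) \<in> I"
    using assms(1) pos by (intro comm_comm_mem c4[unfolded comm4_def]) linarith+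
  ultimately show ?thesis using assms(5) by (simp add: add_mem)
qed

lemma c33_le:
  assumes len: "length a + length b + length c + length d + length e + length f \<le> n"
  shows "comm33 (m a) (m b) (m c) (m d) (m e) (m f) \<in> I"
proof (cases "[] \<in> {a, b, c, d, e, f}")
  case True
  then show ?thesis by (auto simp: comm33_def comm_m_Nil zero_mem)
next
  case False
  then have ne: "a \<noteq> []" "b \<noteq> []" "c \<noteq> []" "d \<noteq> []" "e \<noteq> []" "f \<noteq> []" by auto
  \<comment> \<open>Only the left factor is expanded; a long word in the right factor is brought to
    the left by \<open>c33_flip\<close>.\<close>
  have left: "comm33 (m a) (m b) (m c) (m d) (m e) (m f) \<in> I"
    if len: "length a + length b + length c + length d + length e + length f \<le> n"
      and ne: "a \<noteq> []" "b \<noteq> []" "c \<noteq> []" "d \<noteq> []" "e \<noteq> []" "f \<noteq> []"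
      and split: "2 \<le> length a \<or> 2 \<le> length b \<or> 2 \<le> length c"
    for a b c d e f
  proof -
    from split consider "2 \<le> length a"
      | "2 \<le> length b" | "2 \<le> length c"
      by blast
    then show ?thesis
    proof cases
      case 1
      then obtain u v where "a = u @ v" "u \<noteq> []" "v \<noteq> []" by (rule split_word)
      with ne len show ?thesis by (simp add: c33_mult1)
    next
      case 2
      then obtain u v where "b = u @ v" "u \<noteq> []" "v \<noteq> []" by (rule split_word)
      with ne len uminus_mem[OF c33_mult1[of u v a c d e f]] show ?thesis
        by (simp add: comm33_swap[of _ "m a"])
    next
      case 3
      then obtain u v where "c = u @ v" "u \<noteq> []" "v \<noteq> []" by (rule split_word)
      with ne len show ?thesis by (simp add: c33_mult3)
    qed
  qed
  consider "2 \<le> length a \<or> 2 \<le> length b \<or> 2 \<le> length c"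
    | "2 \<le> length d \<or> 2 \<le> length e \<or> 2 \<le> length f"
    | "length a = 1" "length b = 1" "length c = 1" "length d = 1" "length e = 1" "length f = 1"
    using ne[folded length_greater_0_conv] by linarith
  then show ?thesis
  proof cases
    case 1 then show ?thesis by (rule left[OF len ne])
  next
    case 2 then have "comm33 (m d) (m e) (m f) (m a) (m b) (m c) \<in> I"
      using len ne by (intro left) simp_all
    then show ?thesis by (rule c33_flip[OF len ne(4-6)])
  next
    case 3 then show ?thesis by (auto simp: length_Suc_conv gen_c33)
  qed
qed

section \<open>The family \<open>skew25\<close> at length \<open>n\<close>\<close>

lemma s25_mult1:
  assumes "length u + length v + length b + length c + length d + length e \<le> n"
    "0 < length u" "0 < length v"
  shows "skew25 (m (u @ v)) (m b) (m c) (m d) (m e) \<in> I"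
  unfolding m_append skew25_mult1 using assms
  by (intro add_mem diff_mem lmult_mem[OF s25] rmult_mem[OF s25] lmult_mem[OF c4]) linarith+

lemma s25_mult2:
  assumes "length a + length u + length v + length c + length d + length e \<le> n"
    "0 < length u" "0 < length v"
  shows "skew25 (m a) (m (u @ v)) (m c) (m d) (m e) \<in> I"
  unfolding m_append skew25_mult2 using assms
  by (intro add_mem diff_mem lmult_mem[OF s25] rmult_mem[OF s25] lmult_mem[OF c4] c33_le) linarith+

text \<open>The \<open>comm33\<close> and \<open>skew23\<close> remainders have the same total
  length as the expanded polynomial, so they need \<open>c33_le\<close> and \<open>s23_le\<close>
  rather than the induction hypothesis.\<close>

lemma s25_mult3:
  assumes "length a + length b + length u + length v + length d + length e \<le> n"
    "0 < length a" "0 < length u" "0 < length v"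
  shows "skew25 (m a) (m b) (m (u @ v)) (m d) (m e) \<in> I"
  unfolding m_append skew25_mult3 using assms
  by (intro add_mem diff_mem lmult_mem[OF s25] rmult_mem[OF s25] lmult_mem[OF pairs]
      c33_le s23_le) linarith+

lemma s25_le:
  assumes len: "length a + length b + length c + length d + length e \<le> n"
  shows "skew25 (m a) (m b) (m c) (m d) (m e) \<in> I"
proof (cases "[] \<in> {a, b, c, d, e}")
  case True
  then show ?thesis by (auto simp: skew25_def comm_m_Nil zero_mem)
next
  case False
  then have ne: "a \<noteq> []" "b \<noteq> []" "c \<noteq> []" "d \<noteq> []" "e \<noteq> []" by auto
  consider "2 \<le> length a"
    | "2 \<le> length b" | "2 \<le> length c"
    | "2 \<le> length d" | "2 \<le> length e"
    | "length a = 1" "length b = 1" "length c = 1" "length d = 1" "length e = 1"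
    using ne[folded length_greater_0_conv] by linarith
  then show ?thesis
  proof cases
    case 1
    then obtain u v where "a = u @ v" "u \<noteq> []" "v \<noteq> []" by (rule split_word)
    with ne len show ?thesis by (simp add: s25_mult1)
  next
    case 2
    then obtain u v where "b = u @ v" "u \<noteq> []" "v \<noteq> []" by (rule split_word)
    with ne len show ?thesis by (simp add: s25_mult2)
  next
    case 3
    then obtain u v where "c = u @ v" "u \<noteq> []" "v \<noteq> []" by (rule split_word)
    with ne len show ?thesis by (simp add: s25_mult3)
  next
    case 4
    then obtain u v where "d = u @ v" "u \<noteq> []" "v \<noteq> []" by (rule split_word)
    with ne len uminus_mem[OF s25_mult3[of a b u v c e]] show ?thesis
      by (simp add: skew25_swap(2)[of _ _ _ "m c"])
  next
    case 5
    then obtain u v where "e = u @ v" "u \<noteq> []" "v \<noteq> []" by (rule split_word)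
    with ne len s25_mult2[of a u v c d b] show ?thesis
      by (simp add: skew25_swap(1)[of _ _ _ _ "m b"])
  next
    case 6 then show ?thesis by (auto simp: length_Suc_conv gen_s25)
  qed
qed

section \<open>The family \<open>skew24\<close> at length \<open>n\<close>\<close>

lemma s24_mult1:
  assumes "length u + length v + length b + length c + length d + length e \<le> n"
    "0 < length u" "0 < length v"
  shows "skew24 (m (u @ v)) (m b) (m c) (m d) (m e) \<in> I"
  unfolding m_append skew24_mult1 using assms
  by (intro add_mem diff_mem lmult_mem[OF s24] rmult_mem[OF s24] lmult_mem[OF c4]) linarith+

lemma s24_mult3:
  assumes "length a + length b + length u + length v + length d + length e \<le> n"
    "0 < length a" "0 < length u" "0 < length v"
  shows "skew24 (m a) (m b) (m (u @ v)) (m d) (m e) \<in> I"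
  unfolding m_append skew24_mult3 using assms
  by (intro add_mem diff_mem lmult_mem[OF s24] rmult_mem[OF s24] lmult_mem[OF pairs]
      c33_le s23_le) linarith+

lemma s24_mult4:
  assumes "length a + length b + length c + length u + length v + length e \<le> n"
    "0 < length a" "0 < length c" "0 < length u" "0 < length v" "0 < length e"
  shows "skew24 (m a) (m b) (m c) (m (u @ v)) (m e) \<in> I"
  unfolding m_append skew24_mult4 using assms
  by (intro add_mem diff_mem lmult_mem[OF s24] rmult_mem[OF s24] lmult_mem[OF pairs]
      rmult_mem[OF pairs] lmult_mem[OF c4] c33_le s23_le) linarith+

lemma s24_mult5:
  assumes "length a + length b + length c + length d + length u + length v \<le> n"
    "0 < length u" "0 < length v"
  shows "skew24 (m a) (m b) (m c) (m d) (m (u @ v)) \<in> I"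
  unfolding m_append skew24_mult5 using assms
  by (intro add_mem lmult_mem[OF s24] rmult_mem[OF s24] c33_le) linarith+

lemma s24_le:
  assumes len: "length a + length b + length c + length d + length e \<le> n"
  shows "skew24 (m a) (m b) (m c) (m d) (m e) \<in> I"
proof (cases "[] \<in> {a, b, c, d, e}")
  case True
  then show ?thesis by (auto simp: skew24_def comm_m_Nil zero_mem)
next
  case False
  then have ne: "a \<noteq> []" "b \<noteq> []" "c \<noteq> []" "d \<noteq> []" "e \<noteq> []" by auto
  consider "2 \<le> length a"
    | "2 \<le> length b" | "2 \<le> length c"
    | "2 \<le> length d" | "2 \<le> length e"
    | "length a = 1" "length b = 1" "length c = 1" "length d = 1" "length e = 1"
    using ne[folded length_greater_0_conv] by linarith
  then show ?thesis
  proof cases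
    case 1
    then obtain u v where "a = u @ v" "u \<noteq> []" "v \<noteq> []" by (rule split_word)
    with ne len show ?thesis by (simp add: s24_mult1)
  next
    case 2
    then obtain u v where "b = u @ v" "u \<noteq> []" "v \<noteq> []" by (rule split_word)
    with ne len s24_mult4[of a d c u v e] show ?thesis
      by (simp add: skew24_swap[of _ _ _ "m d"])
  next
    case 3
    then obtain u v where "c = u @ v" "u \<noteq> []" "v \<noteq> []" by (rule split_word)
    with ne len show ?thesis by (simp add: s24_mult3)
  next
    case 4
    then obtain u v where "d = u @ v" "u \<noteq> []" "v \<noteq> []" by (rule split_word)
    with ne len show ?thesis by (simp add: s24_mult4)
  next
    case 5
    then obtain u v where "e = u @ v" "u \<noteq> []" "v \<noteq> []" by (rule split_word)
    with ne len show ?thesis by (simp add: s24_mult5)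
  next
    case 6 then show ?thesis by (auto simp: length_Suc_conv gen_s24)
  qed
qed

section \<open>Fourfold commutators at length \<open>n\<close>\<close>

lemma c4_mult1:
  assumes "length u + length v + length b + length c + length d \<le> n"
    "0 < length u" "0 < length v" "0 < length b" "0 < length c" "0 < length d"
  shows "comm4 (m (u @ v)) (m b) (m c) (m d) \<in> I"
  unfolding m_append comm4_mult1 using assms
  by (intro add_mem lmult_mem[OF c4] rmult_mem[OF c4] s24_le s25_le c3_pair) linarith+

lemma c4_mult3:
  assumes "length a + length b + length u + length v + length d \<le> n"
    "0 < length u" "0 < length v" "0 < length d"
  shows "comm4 (m a) (m b) (m (u @ v)) (m d) \<in> I"
  unfolding m_append comm4_mult3 using assms
  by (intro add_mem diff_mem lmult_mem[OF c4] rmult_mem[OF c4] s25_le c3_pair) linarith+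

lemma c4_mult4:
  assumes "length a + length b + length c + length u + length v \<le> n"
    "0 < length u" "0 < length v"
  shows "comm4 (m a) (m b) (m c) (m (u @ v)) \<in> I"
  unfolding m_append comm4_mult4 using assms
  by (intro add_mem lmult_mem[OF c4] rmult_mem[OF c4]) linarith+

lemma c4_le:
  assumes len: "length a + length b + length c + length d \<le> n"
  shows "comm4 (m a) (m b) (m c) (m d) \<in> I"
proof (cases "[] \<in> {a, b, c, d}")
  case True
  then show ?thesis by (auto simp: comm4_def comm_m_Nil zero_mem)
next
  case False
  then have ne: "a \<noteq> []" "b \<noteq> []" "c \<noteq> []" "d \<noteq> []" by auto
  consider "2 \<le> length a"
    | "2 \<le> length b" | "2 \<le> length c"
    | "2 \<le> length d"
    | "length a = 1" "length b = 1" "length c = 1" "length d = 1"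
    using ne[folded length_greater_0_conv] by linarith
  then show ?thesis
  proof cases
    case 1
    then obtain u v where "a = u @ v" "u \<noteq> []" "v \<noteq> []" by (rule split_word)
    with ne len show ?thesis by (simp add: c4_mult1)
  next
    case 2
    then obtain u v where "b = u @ v" "u \<noteq> []" "v \<noteq> []" by (rule split_word)
    with ne len uminus_mem[OF c4_mult1[of u v a c d]] show ?thesis
      by (simp add: comm4_swap[of _ "m a"])
  next
    case 3
    then obtain u v where "c = u @ v" "u \<noteq> []" "v \<noteq> []" by (rule split_word)
    with ne len show ?thesis by (simp add: c4_mult3)
  next
    case 4
    then obtain u v where "d = u @ v" "u \<noteq> []" "v \<noteq> []" by (rule split_word)
    with ne len show ?thesis by (simp add: c4_mult4)
  next
    case 5 then show ?thesis by (auto simp: length_Suc_conv gen_c4)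
  qed
qed

end

lemma (in two_sided_ideal) comm4_words_mem:
  assumes m: "\<And>u v. m (u @ v) = m u * m v" "m [] = 1"
    and gens: "\<And>y1 y2 y3 y4. comm4 (m [y1]) (m [y2]) (m [y3]) (m [y4]) \<in> I"
      "\<And>y1 y2 y3 y4 y5 y6. comm33 (m [y1]) (m [y2]) (m [y3]) (m [y4]) (m [y5]) (m [y6]) \<in> I"
      "\<And>y1 y2 y3 y4 y5. skew25 (m [y1]) (m [y2]) (m [y3]) (m [y4]) (m [y5]) \<in> I"
      "\<And>y1 y2 y3 y4 y5. skew24 (m [y1]) (m [y2]) (m [y3]) (m [y4]) (m [y5]) \<in> I"
      "\<And>y1 y2 y3 y4 y5 y6. skew23 (m [y1]) (m [y2]) (m [y3]) (m [y4]) (m [y5]) (m [y6]) \<in> I"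
  shows "comm4 (m a) (m b) (m c) (m d) \<in> I"
proof -
  have below: "identities_below I m n" for n
  proof (induction n)
    case 0
    show ?case by unfold_locales (simp_all add: assms)
  next
    case (Suc n)
    then interpret identities_below I m n .
    show ?case
      by unfold_locales
        (simp_all add: m gens less_Suc_eq_le c4_le c33_le s25_le s24_le s23_le)
  qed
  show ?thesis
    \<comment> \<open>Reflexivity chooses \<open>n\<close> as the total length of the four
      words.\<close>
    by (rule identities_below.c4_le[OF below order_refl])
qed

subsection \<open>The free algebra\<close>

definition word_monom :: "'y list \<Rightarrow> ('k::comm_ring_1, 'y) free_alg" where
  "word_monom w = Poly_Mapping.single (FWord w) 1"

lemma word_monom_append: "word_monom (u @ v) = word_monom u * word_monom v"
  by (simp add: word_monom_def mult_single)

lemma word_monom_Nil: "word_monom [] = 1"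
  by (simp add: word_monom_def flip: zero_fword_def)

lemma word_monom_singleton: "word_monom [y] = fvar y"
  by (simp add: word_monom_def fvar_def)

lemma poly_mapping_single_induct [case_names zero single add]:
  assumes "P 0" and "\<And>v k. P (Poly_Mapping.single v k)" and "\<And>x y. P x \<Longrightarrow> P y \<Longrightarrow> P (x + y)"
  shows "P (x :: 'b \<Rightarrow>\<^sub>0 'c::monoid_add)"
proof (induction x rule: update_induct)
  case (update f a b)
  \<comment> \<open>The key \<open>a\<close> is new to \<open>f\<close>, so updating there only adds
    a monomial.\<close>
  have "Poly_Mapping.update a b f = f + Poly_Mapping.single a b"
    using update.hyps
    by (intro poly_mapping_eqI)
      (auto simp: lookup_update lookup_add lookup_single when_def in_keys_iff)
  then show ?case using assms update by simp
qed (rule assms)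

text \<open>The zero of the word monoid is the empty word, so \<open>Poly_Mapping.single 0 k\<close>
  is the scalar \<open>k\<close>.\<close>

lemma scalar_central:
  "Poly_Mapping.single 0 k * z = z * Poly_Mapping.single 0 k" for z :: "('k::comm_ring_1, 'y) free_alg"
  by (induction z rule: poly_mapping_single_induct)
    (simp_all add: mult_single mult.commute distrib_left distrib_right)

lemma free_alg_induct [case_names zero add scalar word]:
  fixes x :: "('k::comm_ring_1, 'y) free_alg"
  assumes zero: "P 0"
    and add: "\<And>x y. P x \<Longrightarrow> P y \<Longrightarrow> P (x + y)"
    and scalar: "\<And>k x. P x \<Longrightarrow> P (Poly_Mapping.single 0 k * x)"
    and word: "\<And>w. P (word_monom w)"
  shows "P x"
proof (induction x rule: poly_mapping_single_induct)
  case (single v k)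
  show ?case
  proof (cases v)
    case (FWord w)
    have "Poly_Mapping.single v k = Poly_Mapping.single 0 k * word_monom w"
      by (simp add: word_monom_def mult_single FWord)
    then show ?thesis using scalar[OF word] by simp
  qed
qed (use zero add in auto)

section \<open>Multilinear extension from words to the whole algebra\<close>

lemma comm4_linear:
  "comm4 (a + a') b c d = comm4 a b c d + comm4 a' b c d"
  "comm4 a (b + b') c d = comm4 a b c d + comm4 a b' c d"
  "comm4 a b (c + c') d = comm4 a b c d + comm4 a b c' d"
  "comm4 a b c (d + d') = comm4 a b c d + comm4 a b c d'"
  "comm4 0 b c d = 0" "comm4 a 0 c d = 0" "comm4 a b 0 d = 0" "comm4 a b c 0 = 0"
  by (simp_all add: comm4_def comm_def algebra_simps)

lemma comm_central_mult:
  fixes s :: "'a::ring"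
  assumes "\<And>z. s * z = z * s"
  shows "comm (s * a) b = s * comm a b" "comm a (s * b) = s * comm a b"
proof -
  have "x * (s * y) = s * (x * y)" for x y
    by (metis assms mult.assoc)
  then show "comm (s * a) b = s * comm a b" "comm a (s * b) = s * comm a b"
    by (simp_all add: comm_def right_diff_distrib mult.assoc)
qed

lemma comm4_central_mult:
  fixes s :: "'a::ring"
  assumes "\<And>z. s * z = z * s"
  shows "comm4 (s * a) b c d = s * comm4 a b c d" "comm4 a (s * b) c d = s * comm4 a b c d"
    "comm4 a b (s * c) d = s * comm4 a b c d" "comm4 a b c (s * d) = s * comm4 a b c d"
  by (simp_all add: comm4_def comm_central_mult[OF assms])

lemma comm4_mem_if_words:
  fixes a b c d :: "('k::comm_ring_1, 'y) free_alg"
  assumes I: "two_sided_ideal J"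
    and words: "\<And>a b c d. comm4 (word_monom a) (word_monom b) (word_monom c) (word_monom d) \<in> J"
  shows "comm4 a b c d \<in> J"
proof -
  interpret J: two_sided_ideal J by (rule I)
  \<comment> \<open>One argument at a time is freed from being a word, by linearity in it.\<close>
  have 1: "comm4 a (word_monom b) (word_monom c) (word_monom d) \<in> J" for a b c d
    by (induction a rule: free_alg_induct)
      (simp_all add: comm4_linear comm4_central_mult[OF scalar_central] words J.zero_mem J.add_mem J.lmult_mem)
  have 2: "comm4 a b (word_monom c) (word_monom d) \<in> J" for a b c d
    by (induction b rule: free_alg_induct)
      (simp_all add: comm4_linear comm4_central_mult[OF scalar_central] 1 J.zero_mem J.add_mem J.lmult_mem)
  have 3: "comm4 a b c (word_monom d) \<in> J" for a b c d
    by (induction c rule: free_alg_induct)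
      (simp_all add: comm4_linear comm4_central_mult[OF scalar_central] 2 J.zero_mem J.add_mem J.lmult_mem)
  show ?thesis
    by (induction d rule: free_alg_induct)
      (simp_all add: comm4_linear comm4_central_mult[OF scalar_central] 3 J.zero_mem J.add_mem J.lmult_mem)
qed

theorem theorem1p3:
  shows "ideal_gen {comm (comm (comm a1 a2) a3) a4 :: ('k::comm_ring_1, 'y) free_alg | a1 a2 a3 a4. True}
    = ideal_gen
       ({comm (comm (comm (fvar y1) (fvar y2)) (fvar y3)) (fvar y4) :: ('k::comm_ring_1, 'y) free_alg
           | y1 y2 y3 y4. True}
        \<union> {comm (comm (fvar y1) (fvar y2)) (fvar y3) * comm (comm (fvar y4) (fvar y5)) (fvar y6)
           | y1 y2 y3 y4 y5 y6. True}
        \<union> {comm (fvar y1) (fvar y2) * comm (comm (fvar y3) (fvar y4)) (fvar y5)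
             + comm (fvar y1) (fvar y5) * comm (comm (fvar y3) (fvar y4)) (fvar y2)
           | y1 y2 y3 y4 y5. True}
        \<union> {comm (fvar y1) (fvar y2) * comm (comm (fvar y3) (fvar y4)) (fvar y5)
             + comm (fvar y1) (fvar y4) * comm (comm (fvar y3) (fvar y2)) (fvar y5)
           | y1 y2 y3 y4 y5. True}
        \<union> {(comm (fvar y1) (fvar y2) * comm (fvar y3) (fvar y4)
              + comm (fvar y1) (fvar y3) * comm (fvar y2) (fvar y4)) * comm (fvar y5) (fvar y6)
           | y1 y2 y3 y4 y5 y6. True})"
  (is "ideal_gen ?T = ideal_gen ?G")
proof
  interpret T: two_sided_ideal "ideal_gen ?T" by (rule ideal_gen_two_sided)
  interpret T: comm4_ideal "ideal_gen ?T"
  proof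
    fix a b c d :: "('k, 'y) free_alg"
    have "comm4 a b c d \<in> ?T" unfolding comm4_def by blast
    then show "comm4 a b c d \<in> ideal_gen ?T" by (rule ideal_gen.gen)
  qed
  show "ideal_gen ?G \<subseteq> ideal_gen ?T"
    \<comment> \<open>Each generator is an instance, at variables, of a family shown to lie in the
      ideal for arbitrary arguments.\<close>
    by (rule ideal_gen_subset, elim UnE CollectE exE conjE; hypsubst)
      (rule T.c4[unfolded comm4_def] T.c33[unfolded comm33_def] T.s25[unfolded skew25_def]
        T.s24[unfolded skew24_def] T.s23[unfolded skew23_def])+
  have "comm4 (word_monom a) (word_monom b) (word_monom c) (word_monom d) \<in> ideal_gen ?G" for a b c d
  proof (rule two_sided_ideal.comm4_words_mem[OF ideal_gen_two_sided word_monom_append word_monom_Nil];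
      unfold word_monom_singleton poly_defs; rule ideal_gen.gen)
    fix y1 y2 y3 y4 y5 y6 :: 'y
    let ?v = "fvar :: 'y \<Rightarrow> ('k, 'y) free_alg"
    show "comm (comm3 (?v y1) (?v y2) (?v y3)) (?v y4) \<in> ?G"
      by (rule UnI1, rule UnI1, rule UnI1, rule UnI1) blast
    show "comm3 (?v y1) (?v y2) (?v y3) * comm3 (?v y4) (?v y5) (?v y6) \<in> ?G"
      by (rule UnI1, rule UnI1, rule UnI1, rule UnI2) blast
    show "comm (?v y1) (?v y2) * comm3 (?v y3) (?v y4) (?v y5)
        + comm (?v y1) (?v y5) * comm3 (?v y3) (?v y4) (?v y2) \<in> ?G"
      by (rule UnI1, rule UnI1, rule UnI2) blast
    show "comm (?v y1) (?v y2) * comm3 (?v y3) (?v y4) (?v y5)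
        + comm (?v y1) (?v y4) * comm3 (?v y3) (?v y2) (?v y5) \<in> ?G"
      by (rule UnI1, rule UnI2) blast
    show "(comm (?v y1) (?v y2) * comm (?v y3) (?v y4)
        + comm (?v y1) (?v y3) * comm (?v y2) (?v y4)) * comm (?v y5) (?v y6) \<in> ?G"
      by (rule UnI2) blast
  qed
  then have "comm4 a b c d \<in> ideal_gen ?G" for a b c d
    by (rule comm4_mem_if_words[OF ideal_gen_two_sided])
  then show "ideal_gen ?T \<subseteq> ideal_gen ?G"
    by (intro ideal_gen_subset, elim CollectE exE conjE; hypsubst) (unfold comm4_def)
qed

end
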